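(* Let $A\in\mathbb{R}^{m\times n}$, $b\in\mathbb{R}^m$, $\mu>0$, and let $x^*$ be an optimal solution to the Lasso problem $\min_{x\in\mathbb{R}^n}\frac12\|Ax-b\|^2+\mu\|x\|_1$. Let $\mathcal{E}:=\{j\in\{1,\ldots,n\}: |(A^T(Ax^*-b))_j|=\mu\}$, $K:=\{j\in\mathcal{E}: x^*_j=0\}$, $J:=\mathcal{E}\setminus K$, and $Q_K:=\mathrm{Diag}\big[\mathrm{sign}(A_K^T(A_Jx^*_J-b))\big]$. The following statements are equivalent: (i) $x^*$ is the unique optimal solution to the Lasso problem. (ii) The system $A_Jx_J-A_KQ_Kx_K=0$ and $x_K\in\mathbb{R}^K_+$ has a unique solution $(x_J,x_K)=(0_J,0_K)\in\mathbb{R}^J\times\mathbb{R}^K$. (iii) The submatrix $A_J$ has full column rank and the columns of $A_JA_J^\dagger A_KQ_K-A_KQ_K$ are positively linearly independent in the sense that $$\mathrm{Ker}\,(A_JA_J^\dagger A_KQ_K-A_KQ_K)\cap\mathbb{R}^K_+=\{0_K\},$$ where $A_J^\dagger:=(A_J^TA_J)^{-1}A_J^T$ is the Moore–Penrose pseudoinverse of $A_J$. (iv) The submatrix $A_J$ has full column rank and there exists a Slater point $y\in\mathbb{R}^m$ such that $$(Q_KA_K^TA_JA_J^\dagger-Q_KA_K^T)y<0$$ (all components negative).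
   Context: For an index set $I\subset\{1,\ldots,n\}$, $A_I$ is the submatrix of $A$ formed by its columns $A_i$, $i\in I$, and $x_I$ is the subvector of $x\in\mathbb{R}^n$ formed by $x_i$, $i\in I$. $\mathrm{sign}(x)=(\mathrm{sign}(x_1),\ldots,\mathrm{sign}(x_n))^T$, and $\mathrm{Diag}(x)$ is the square diagonal matrix with diagonal entries $x_1,\ldots,x_n$. (One has $J=\{j: x^*_j\ne0\}$ by optimality.) Conditions involving an empty index set are understood in the usual vacuous sense (e.g. $A_\emptyset$ has full column rank and $A_JA_J^\dagger=0$ if $J=\emptyset$). *)

theory Defs
  imports
    "Jordan_Normal_Form.DL_Rank"
    "Jordan_Normal_Form.DL_Submatrix"
    "Jordan_Normal_Form.Matrix_Kernel"
    "Jordan_Normal_Form.Gauss_Jordan_Elimination"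
begin

text \<open>Coordinates and columns are numbered from \<open>0\<close>. For an index set \<open>I\<close> the spaces of vectors
  indexed by \<open>I\<close> are rendered as \<^term>\<open>carrier_vec (card I)\<close>; position \<open>i\<close> corresponds to the
  \<open>i\<close>-th smallest element \<^term>\<open>pick I i\<close> of \<open>I\<close>, which is the convention of \<^const>\<open>submatrix\<close>.\<close>

definition cols_sub :: "'a mat \<Rightarrow> nat set \<Rightarrow> 'a mat" where
  "cols_sub A I = submatrix A UNIV I"

definition subvec :: "'a vec \<Rightarrow> nat set \<Rightarrow> 'a vec" where
  "subvec x I = vec (card {i. i < dim_vec x \<and> i \<in> I}) (\<lambda>i. x $ pick I i)"

definition sign_vec :: "real vec \<Rightarrow> real vec" where
  "sign_vec x = map_vec sgn x"

definition Diag :: "real vec \<Rightarrow> real mat" where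
  "Diag x = mat_diag (dim_vec x) (\<lambda>i. x $ i)"

definition norm_2 :: "real vec \<Rightarrow> real" where
  "norm_2 v = sqrt (v \<bullet> v)"

definition norm_1 :: "real vec \<Rightarrow> real" where
  "norm_1 v = (\<Sum>i<dim_vec v. \<bar>v $ i\<bar>)"

definition lasso_objective :: "real mat \<Rightarrow> real vec \<Rightarrow> real \<Rightarrow> real vec \<Rightarrow> real" where
  "lasso_objective A b \<mu> x = 1 / 2 * (norm_2 (A *\<^sub>v x - b))\<^sup>2 + \<mu> * norm_1 x"

definition lasso_solutions :: "real mat \<Rightarrow> real vec \<Rightarrow> real \<Rightarrow> real vec set" where
  "lasso_solutions A b \<mu> =
    {x \<in> carrier_vec (dim_col A).
      \<forall>x' \<in> carrier_vec (dim_col A). lasso_objective A b \<mu> x \<le> lasso_objective A b \<mu> x'}"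

definition full_column_rank :: "real mat \<Rightarrow> bool" where
  "full_column_rank B \<longleftrightarrow> vec_space.rank (dim_row B) B = dim_col B"

text \<open>The formula below is meaningful only if \<open>B\<close> has full column rank: otherwise
  \<^term>\<open>B\<^sup>T * B\<close> is singular, \<^const>\<open>mat_inverse\<close> returns \<^const>\<open>None\<close>, and the value is unspecified.
  If \<open>B\<close> has no columns, \<open>B * pinv B\<close> is the zero matrix.\<close>

definition pinv :: "real mat \<Rightarrow> real mat" where
  "pinv B = the (mat_inverse (B\<^sup>T * B)) * B\<^sup>T"

end

theory Submission
  imports Defs
begin

text \<open>
  Let \<open>g = A\<^sup>T (A x\<^sup>* - b)\<close>. Along a direction \<open>h\<close> the Lasso objective grows by
  \<open>1/2 * \<parallel>A h\<parallel>\<^sup>2 + (\<Sum>i. g\<^sub>i h\<^sub>i + \<mu> (\<bar>x\<^sup>*\<^sub>i + h\<^sub>i\<bar> - \<bar>x\<^sup>*\<^sub>i\<bar>))\<close>,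
  and optimality of \<open>x\<^sup>*\<close> makes each summand nonnegative (\<open>lasso_optimality\<close>). So \<open>x\<^sup>* + h\<close> is optimal
  iff \<open>A h = 0\<close> and all the summands vanish. Up to scaling of \<open>h\<close>, they vanish iff \<open>h\<close> is zero
  off \<open>E\<close> and \<open>g\<^sub>i h\<^sub>i \<le> 0\<close> on \<open>K\<close>. Hence uniqueness means that the only such \<open>h\<close> in the kernel of \<open>A\<close> is
  zero (\<open>lasso_unique_iff_direction\<close>).

  Writing \<open>h\<^sub>J = x\<^sub>J\<close> and \<open>h\<^sub>K = - Q\<^sub>K x\<^sub>K\<close> with \<open>x\<^sub>K \<ge> 0\<close> turns this condition into the
  system of (ii) (\<open>direction_iff_signed_system\<close>). Condition (ii) forces \<open>A\<^sub>J\<close> to be injective, and then \<open>A\<^sub>J A\<^sub>J\<^sup>\<dagger>\<close> is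
  the orthogonal projection onto the range of \<open>A\<^sub>J\<close>; eliminating \<open>x\<^sub>J\<close> by means of it gives (iii)
  (\<open>trivial_cone_kernel_iff\<close>). Since the projection is symmetric, the matrix in (iv) is the transpose of the one in
  (iii), and (iii) and (iv) are the two sides of Gordan's alternative (\<open>gordan_mat\<close>), proved here by
  induction on the number of columns.
\<close>

section \<open>Gordan's theorem of the alternative\<close>

lemma mult_mat_zero_vec:
  fixes M :: "'a :: semiring_0 mat"
  assumes "M \<in> carrier_mat m k"
  shows "M *\<^sub>v 0\<^sub>v k = 0\<^sub>v m"
  using assms by (intro eq_vecI) auto

text \<open>Adding one more vector \<open>a k\<close> to a family without a positive dependency: the induction
  hypothesis gives \<open>y\<close> strictly negative on the old family. If \<open>a k\<close> is positive on \<open>y\<close>, replace each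
  \<open>a i\<close> by the combination of \<open>a i\<close> and \<open>a k\<close> with positive coefficients that vanishes on \<open>y\<close>. A positive dependency
  among these combinations would be one among the original vectors, so the hypothesis applies again
  and yields a \<open>z\<close> which, corrected by a multiple of \<open>y\<close>, vanishes on \<open>a k\<close> and stays negative on the
  old family. Moving slightly along \<open>- a k\<close> then makes all the products negative.\<close>

lemma gordan_alternative:
  fixes a :: "'i \<Rightarrow> 's \<Rightarrow> real"
  assumes "finite I" "finite S"
  shows "(\<exists>y. \<forall>i\<in>I. (\<Sum>r\<in>S. a i r * y r) < 0) \<or>
         (\<exists>c. (\<forall>i\<in>I. 0 \<le> c i) \<and> (\<exists>i\<in>I. c i \<noteq> 0) \<and> (\<forall>r\<in>S. (\<Sum>i\<in>I. c i * a i r) = 0))"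
  using \<open>finite I\<close>
proof (induction I arbitrary: a rule: finite_induct)
  case empty
  then show ?case by simp
next
  case (insert k I)
  define ip where "ip u v = (\<Sum>r\<in>S. u r * v r)" for u v :: "'s \<Rightarrow> real"
  have ip_lin: "ip u (\<lambda>r. s * v r + t * w r) = s * ip u v + t * ip u w" for u v w s t
    by (simp add: ip_def sum.distrib sum_distrib_left algebra_simps)
  have ip_lin': "ip (\<lambda>r. s * v r + t * w r) u = s * ip v u + t * ip w u" for u v w s t
    by (simp add: ip_def sum.distrib sum_distrib_left algebra_simps)
  have ip_pos: "0 < ip u u" if "r \<in> S" "u r \<noteq> 0" for u r
    unfolding ip_def using that \<open>finite S\<close>
    by (intro sum_pos2[of S r]) (auto simp: zero_less_mult_iff)
  let ?dep = "\<lambda>I a. \<exists>c. (\<forall>i\<in>I. 0 \<le> c i) \<and> (\<exists>i\<in>I. c i \<noteq> 0) \<and>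
    (\<forall>r\<in>S. (\<Sum>i\<in>I. c i * a i r) = (0::real))"
  show ?case
  proof (cases "?dep (insert k I) a")
    case False
    have ndep: "\<not> ?dep I a"
    proof
      assume "?dep I a"
      then obtain c where c: "\<forall>i\<in>I. 0 \<le> c i" "\<exists>i\<in>I. c i \<noteq> 0" "\<forall>r\<in>S. (\<Sum>i\<in>I. c i * a i r) = 0"
        by blast
      have "(\<Sum>i\<in>I. (if i = k then 0 else c i) * a i r) = (\<Sum>i\<in>I. c i * a i r)" for r
        using insert.hyps by (intro sum.cong) auto
      moreover have "\<exists>i\<in>insert k I. (if i = k then 0 else c i) \<noteq> 0"
      proof -
        obtain i where "i \<in> I" "c i \<noteq> 0" using c(2) by blast
        then show ?thesis using insert.hyps by (intro bexI[of _ i]) auto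
      qed
      ultimately have "?dep (insert k I) a"
        using c(1,3) insert.hyps by (intro exI[of _ "\<lambda>i. if i = k then 0 else c i"]) simp
      then show False using False by simp
    qed
    then obtain y where y: "\<And>i. i \<in> I \<Longrightarrow> ip (a i) y < 0"
      using insert.IH[of a] unfolding ip_def by auto
    have "\<exists>r\<in>S. a k r \<noteq> 0"
    proof (rule ccontr)
      assume *: "\<not> ?thesis"
      have "(\<Sum>i\<in>I. (if i = k then 1 else 0) * a i r) = 0" for r
        using insert.hyps by (intro sum.neutral) auto
      then have "?dep (insert k I) a"
        using * insert.hyps by (intro exI[of _ "\<lambda>i. if i = k then 1 else 0"]) auto
      then show False using False by simp
    qed
    then have kk: "ip (a k) (a k) > 0" using ip_pos by blast
    obtain z where z: "\<And>i. i \<in> I \<Longrightarrow> ip (a i) z < 0" "ip (a k) z \<le> 0"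
    proof (cases "ip (a k) y \<le> 0")
      case True
      then show ?thesis using y that by blast
    next
      case False
      define s where "s = ip (a k) y"
      have s: "s > 0" using False s_def by simp
      \<comment> \<open>Chosen such that the product of each \<open>w i\<close> with \<open>y\<close> is zero.\<close>
      define w where "w i = (\<lambda>r. s * a i r + (- ip (a i) y) * a k r)" for i
      have "\<not> ?dep I w"
      proof
        assume "?dep I w"
        then obtain c where c: "\<forall>i\<in>I. 0 \<le> c i" "\<exists>i\<in>I. c i \<noteq> 0"
          "\<forall>r\<in>S. (\<Sum>i\<in>I. c i * w i r) = 0" by blast
        define d where "d = (\<lambda>i. if i = k then (\<Sum>i\<in>I. c i * (- ip (a i) y)) else c i * s)"
        have dI: "(\<Sum>i\<in>I. d i * a i r) = (\<Sum>i\<in>I. c i * s * a i r)" for r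
          using insert.hyps by (intro sum.cong) (auto simp: d_def)
        have "(\<Sum>i\<in>insert k I. d i * a i r) = (\<Sum>i\<in>I. c i * w i r)" for r
          unfolding sum.insert[OF insert.hyps] dI w_def
          by (simp add: d_def sum_distrib_left algebra_simps sum_subtractf sum_negf)
        moreover have "0 \<le> d k"
          unfolding d_def using c(1) y by (auto intro!: sum_nonneg mult_nonneg_nonpos simp: less_imp_le)
        moreover have "\<forall>i\<in>I. 0 \<le> d i \<and> (c i \<noteq> 0 \<longrightarrow> d i \<noteq> 0)"
          using c(1) s insert.hyps by (auto simp: d_def)
        ultimately have "?dep (insert k I) a"
          using c(2,3) by (intro exI[of _ d]) auto
        then show False using \<open>\<not> ?dep (insert k I) a\<close> by simp
      qed
      then obtain z where z: "\<And>i. i \<in> I \<Longrightarrow> ip (w i) z < 0"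
        using insert.IH[of w] unfolding ip_def by auto
      show ?thesis
      proof (rule that[of "\<lambda>r. s * z r + (- ip (a k) z) * y r"])
        show "ip (a i) (\<lambda>r. s * z r + (- ip (a k) z) * y r) < 0" if "i \<in> I" for i
          using z[OF that] unfolding w_def ip_lin ip_lin' by (simp add: algebra_simps)
        show "ip (a k) (\<lambda>r. s * z r + (- ip (a k) z) * y r) \<le> 0"
          unfolding ip_lin by (simp add: s_def)
      qed
    qed
    \<comment> \<open>A multiple of \<open>z\<close> this large outweighs, on each vector of the old family, the change caused by
      subtracting \<open>a k\<close>.\<close>
    define M where "M = (\<Sum>i\<in>I. \<bar>ip (a i) (a k)\<bar> / - ip (a i) z)"
    have M: "\<bar>ip (a i) (a k)\<bar> \<le> M * - ip (a i) z" if "i \<in> I" for i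
    proof -
      have "\<bar>ip (a i) (a k)\<bar> / - ip (a i) z \<le> M" unfolding M_def
        using that insert.hyps z(1)
        by (intro member_le_sum) (auto simp: less_imp_le intro!: divide_nonneg_pos divide_nonneg_neg)
      then show ?thesis using z(1)[OF that] by (simp add: field_simps)
    qed
    have "ip (a i) (\<lambda>r. (M + 1) * z r + (-1) * a k r) < 0" if "i \<in> insert k I" for i
    proof (cases "i = k")
      case True
      have "M \<ge> 0" unfolding M_def using z(1) 
        by (intro sum_nonneg) (auto simp: less_imp_le intro!: divide_nonneg_pos divide_nonneg_neg)
      then have "(M + 1) * ip (a k) z \<le> 0" using z(2) by (intro mult_nonneg_nonpos) auto
      then show ?thesis unfolding ip_lin using kk True by simp
    next
      case False
      then have "i \<in> I" using that by simp
      from M[OF this] z(1)[OF this] show ?thesis unfolding ip_lin by (simp add: algebra_simps)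
    qed
    then have "\<forall>i\<in>insert k I. (\<Sum>r\<in>S. a i r * ((M + 1) * z r + (-1) * a k r)) < 0"
      unfolding ip_def by (rule ballI)
    then show ?thesis by (intro disjI1 exI)
  qed (rule disjI2)
qed

text \<open>If \<open>M x = 0\<close> with \<open>x \<ge> 0\<close>, then \<open>0 = y \<bullet> M x = M\<^sup>T y \<bullet> x\<close> is a sum of nonpositive
  terms, which vanishes only for \<open>x = 0\<close>. The converse is the alternative above for the columns of \<open>M\<close>.\<close>

lemma gordan_mat:
  fixes M :: "real mat"
  assumes M: "M \<in> carrier_mat m k"
  shows "mat_kernel M \<inter> {v \<in> carrier_vec k. 0\<^sub>v k \<le> v} = {0\<^sub>v k} \<longleftrightarrow>
         (\<exists>y \<in> carrier_vec m. \<forall>i<k. (M\<^sup>T *\<^sub>v y) $ i < 0)" (is "?l \<longleftrightarrow> ?r")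
proof
  assume ?r
  then obtain y where y: "y \<in> carrier_vec m" "\<forall>i<k. (M\<^sup>T *\<^sub>v y) $ i < 0" by blast
  have "x = 0\<^sub>v k" if x: "x \<in> carrier_vec k" "0\<^sub>v k \<le> x" "M *\<^sub>v x = 0\<^sub>v m" for x
  proof -
    have "(M\<^sup>T *\<^sub>v y) \<bullet> x = y \<bullet> (M *\<^sub>v x)"
      using M x(1) y(1) by (rule transpose_vec_mult_scalar)
    then have "(\<Sum>i<k. - ((M\<^sup>T *\<^sub>v y) $ i * x $ i)) = 0"
      using x(1,3) y(1) M by (simp add: scalar_prod_def sum_negf lessThan_atLeast0)
    moreover have "0 \<le> - ((M\<^sup>T *\<^sub>v y) $ i * x $ i)" if "i < k" for i
    proof -
      have "(M\<^sup>T *\<^sub>v y) $ i \<le> 0" "0 \<le> x $ i"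
        using y(2) x(1,2) that by (auto simp: less_eq_vec_def less_imp_le)
      then show ?thesis by (simp add: mult_nonpos_nonneg)
    qed
    ultimately have "\<forall>i\<in>{..<k}. - ((M\<^sup>T *\<^sub>v y) $ i * x $ i) = 0"
      by (subst (asm) sum_nonneg_eq_0_iff) auto
    then have "x $ i = 0" if "i < k" for i using y(2) that by force
    then show ?thesis using x(1) by (intro eq_vecI) auto
  qed
  then have "mat_kernel M \<inter> {v \<in> carrier_vec k. 0\<^sub>v k \<le> v} \<subseteq> {0\<^sub>v k}"
    unfolding mat_kernel[OF M] by blast
  moreover have "M *\<^sub>v 0\<^sub>v k = 0\<^sub>v m" by (rule mult_mat_zero_vec[OF M])
  then have "0\<^sub>v k \<in> mat_kernel M" by (intro mat_kernelI[OF M]) auto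
  ultimately show ?l by auto
next
  assume l: ?l
  have "\<not> (\<exists>c. (\<forall>i\<in>{..<k}. 0 \<le> c i) \<and> (\<exists>i\<in>{..<k}. c i \<noteq> 0) \<and>
      (\<forall>r\<in>{..<m}. (\<Sum>i<k. c i * M $$ (r, i)) = 0))"
  proof (intro notI, elim exE conjE)
    fix c assume c: "\<forall>i\<in>{..<k}. 0 \<le> c i" "\<exists>i\<in>{..<k}. c i \<noteq> 0"
      "\<forall>r\<in>{..<m}. (\<Sum>i<k. c i * M $$ (r, i)) = (0::real)"
    have "(M *\<^sub>v vec k c) $ r = 0\<^sub>v m $ r" if "r < m" for r
      using c(3) M that by (simp add: scalar_prod_def lessThan_atLeast0 mult.commute)
    then have "M *\<^sub>v vec k c = 0\<^sub>v m" using M by (intro eq_vecI) simp_all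
    then have "vec k c \<in> mat_kernel M" by (intro mat_kernelI[OF M]) auto
    moreover have "0\<^sub>v k \<le> vec k c" using c(1) by (auto simp: less_eq_vec_def)
    ultimately have "vec k c \<in> {0\<^sub>v k}" unfolding l[symmetric] by simp
    then have "vec k c $ i = 0" if "i < k" for i using that by simp
    then show False using c(2) by simp
  qed
  then obtain y where y: "\<forall>i\<in>{..<k}. (\<Sum>r<m. M $$ (r, i) * y r) < 0"
    using gordan_alternative[of "{..<k}" "{..<m}" "\<lambda>i r. M $$ (r, i)"] by auto
  show ?r
  proof (intro bexI[of _ "vec m y"] allI impI)
    fix i assume "i < k"
    then show "(M\<^sup>T *\<^sub>v vec m y) $ i < 0"
      using y M by (simp add: scalar_prod_def lessThan_atLeast0)
  qed simp
qed

section \<open>Full column rank and the pseudoinverse\<close>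

text \<open>Linear independence in \<^const>\<open>vec_space.rank\<close> refers to the set of columns, in which equal
  columns coincide. Hence both directions first show that the columns are distinct: a rank equal to
  the number of columns leaves no room for repetition, and if two columns agree, the difference of the two unit vectors is in the
  kernel.\<close>

lemma full_column_rank_iff:
  assumes B: "B \<in> carrier_mat m p"
  shows "full_column_rank B \<longleftrightarrow> (\<forall>v \<in> carrier_vec p. B *\<^sub>v v = 0\<^sub>v m \<longrightarrow> v = 0\<^sub>v p)"
proof -
  interpret vec_space "TYPE(real)" m .
  have len: "length (cols B) = p" using B by simp
  have rk: "full_column_rank B \<longleftrightarrow> rank B = p" using B by (simp add: full_column_rank_def)
  show ?thesis
  proof
    assume "full_column_rank B"
    then have r: "rank B = p" using rk by simp
    have "distinct (cols B)"
    proof -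
      obtain S where S: "finite S" "maximal S (\<lambda>T. T \<subseteq> set (cols B) \<and> lin_indpt T)"
        using maximal_exists_superset[of "set (cols B)" "\<lambda>T. T \<subseteq> set (cols B) \<and> lin_indpt T" "{}"]
        by (auto simp: lin_dep_def)
      then have "p = card S" using rank_card_indpt[OF B] r by simp
      moreover have "S \<subseteq> set (cols B)" using S(2) by (auto simp: maximal_def)
      ultimately have "p \<le> card (set (cols B))" by (simp add: card_mono)
      then show ?thesis using len card_length[of "cols B"] by (simp add: card_distinct)
    qed
    then show "\<forall>v \<in> carrier_vec p. B *\<^sub>v v = 0\<^sub>v m \<longrightarrow> v = 0\<^sub>v p"
      using full_rank_lin_indpt[OF B r] lin_depI[OF B] by blast
  next
    assume inj: "\<forall>v \<in> carrier_vec p. B *\<^sub>v v = 0\<^sub>v m \<longrightarrow> v = 0\<^sub>v p"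
    have d: "distinct (cols B)"
    proof (rule ccontr)
      assume "\<not> distinct (cols B)"
      then obtain i j where ij: "i < p" "j < p" "i \<noteq> j" "col B i = col B j"
        using B len by (auto simp: distinct_conv_nth)
      have "B *\<^sub>v (unit_vec p i - unit_vec p j) = 0\<^sub>v m"
        using ij B by (auto simp: mult_minus_distrib_mat_vec[OF B] vec_eq_iff col_def)
      then have "unit_vec p i - unit_vec p j = (0\<^sub>v p :: real vec)" using inj by auto
      then have "(unit_vec p i - unit_vec p j) $ i = (0\<^sub>v p :: real vec) $ i" by simp
      then show False using ij by simp
    qed
    moreover have "lin_indpt (set (cols B))"
      using lin_depE[OF B _ d] inj by metis
    ultimately show "full_column_rank B" using lin_indpt_full_rank[OF B] rk by simp
  qed
qed

lemma scalar_prod_self_eq_0: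
  fixes v :: "real vec"
  shows "v \<bullet> v = 0 \<longleftrightarrow> v = 0\<^sub>v (dim_vec v)"
proof
  assume "v \<bullet> v = 0"
  then have "\<forall>i\<in>{0..<dim_vec v}. v $ i * v $ i = 0"
    unfolding scalar_prod_def by (subst (asm) sum_nonneg_eq_0_iff) auto
  then show "v = 0\<^sub>v (dim_vec v)" by (intro eq_vecI) auto
next
  assume *: "v = 0\<^sub>v (dim_vec v)"
  show "v \<bullet> v = 0" by (subst *) simp
qed

text \<open>If \<open>B\<^sup>T B v = 0\<close>, then \<open>v \<bullet> B\<^sup>T B v\<close>, which is the square of the norm of \<open>B v\<close>, is
  zero; so \<open>B\<^sup>T B\<close> is invertible. Its inverse is symmetric, whence \<open>B * pinv B\<close> is the symmetric
  projection onto the range of \<open>B\<close>.\<close>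

lemma pinv_full_column_rank:
  assumes B: "B \<in> carrier_mat m p" and fr: "full_column_rank B"
  shows "pinv B \<in> carrier_mat p m" "pinv B * B = 1\<^sub>m p" "(B * pinv B)\<^sup>T = B * pinv B"
proof -
  let ?G = "B\<^sup>T * B"
  have G: "?G \<in> carrier_mat p p" using B by simp
  have "v = 0\<^sub>v p" if v: "v \<in> carrier_vec p" "?G *\<^sub>v v = 0\<^sub>v p" for v
  proof -
    have "(B *\<^sub>v v) \<bullet> (B *\<^sub>v v) = (B\<^sup>T *\<^sub>v (B *\<^sub>v v)) \<bullet> v"
      using B v by (subst transpose_vec_mult_scalar[OF B]) auto
    also have "\<dots> = 0" using B v by simp
    finally have "B *\<^sub>v v = 0\<^sub>v m" using B scalar_prod_self_eq_0[of "B *\<^sub>v v"] by simp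
    then show ?thesis using fr v(1) full_column_rank_iff[OF B] by blast
  qed
  then have "det ?G \<noteq> 0" using det_0_iff_vec_prod_zero[OF G] by blast
  then obtain H where H: "mat_inverse ?G = Some H"
    using mat_inverse(1)[OF G, of "()"] det_non_zero_imp_unit[OF G, of "()"] by (cases "mat_inverse ?G") auto
  then have HG: "?G * H = 1\<^sub>m p" "H * ?G = 1\<^sub>m p" "H \<in> carrier_mat p p" using mat_inverse(2)[OF G H] by auto
  have p: "pinv B = H * B\<^sup>T" by (simp add: pinv_def H)
  show "pinv B \<in> carrier_mat p m" using p HG B by simp
  show "pinv B * B = 1\<^sub>m p" using p HG B by simp
  have GT: "?G\<^sup>T = ?G" using B by (simp add: transpose_mult[of "B\<^sup>T" p m B p])
  have "H\<^sup>T * ?G = 1\<^sub>m p"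
    using transpose_mult[OF G HG(3)] HG GT by simp
  then have "H\<^sup>T * (?G * H) = H" using G HG(3)
    by (subst assoc_mult_mat[symmetric, of _ p p _ p _ p]) auto
  then have HT: "H\<^sup>T = H" using HG by simp
  have "(B * (H * B\<^sup>T))\<^sup>T = (H * B\<^sup>T)\<^sup>T * B\<^sup>T"
    using B HG by (simp add: transpose_mult[of B m p _ m])
  also have "(H * B\<^sup>T)\<^sup>T = B * H"
    using B HG HT by (simp add: transpose_mult[of H p p _ m])
  finally show "(B * pinv B)\<^sup>T = B * pinv B"
    unfolding p using B HG by simp
qed

text \<open>For \<open>B\<close> of full column rank, \<open>B * pinv B\<close> fixes exactly the vectors in the range of \<open>B\<close>. So
  \<open>z\<close> is in the kernel of \<open>B * pinv B * C - C\<close> iff \<open>C z = B x\<close> for some \<open>x\<close>, and this \<open>x\<close> is zero as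
  soon as \<open>z\<close> is. If \<open>B\<close> is not injective, a kernel vector of \<open>B\<close> together with \<open>z = 0\<close> solves the
  system.\<close>

lemma trivial_cone_kernel_iff:
  assumes B: "B \<in> carrier_mat m p" and C: "C \<in> carrier_mat m q"
  shows "(\<forall>x \<in> carrier_vec p. \<forall>z \<in> carrier_vec q.
            (B *\<^sub>v x - C *\<^sub>v z = 0\<^sub>v m \<and> 0\<^sub>v q \<le> z) \<longleftrightarrow> (x = 0\<^sub>v p \<and> z = 0\<^sub>v q)) \<longleftrightarrow>
         full_column_rank B \<and>
         mat_kernel (B * pinv B * C - C) \<inter> {v \<in> carrier_vec q. 0\<^sub>v q \<le> v} = {0\<^sub>v q}"
    (is "?l \<longleftrightarrow> _ \<and> ?k")
proof -
  have minus0: "u - v = 0\<^sub>v m \<longleftrightarrow> u = v" if "u \<in> carrier_vec m" "v \<in> carrier_vec m" for u v :: "real vec"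
    using that by (auto simp: vec_eq_iff)
  have eq: "B *\<^sub>v x - C *\<^sub>v z = 0\<^sub>v m \<longleftrightarrow> B *\<^sub>v x = C *\<^sub>v z"
    if "x \<in> carrier_vec p" "z \<in> carrier_vec q" for x z
    using that B C by (intro minus0) auto
  show ?thesis
  proof (cases "full_column_rank B")
    case False
    then obtain x where "x \<in> carrier_vec p" "B *\<^sub>v x = 0\<^sub>v m" "x \<noteq> 0\<^sub>v p"
      using full_column_rank_iff[OF B] by blast
    moreover have "B *\<^sub>v x - C *\<^sub>v 0\<^sub>v q = 0\<^sub>v m" if "B *\<^sub>v x = 0\<^sub>v m" for x
      using that C by auto
    ultimately have "\<not> ?l" by (metis order_refl zero_carrier_vec)
    then show ?thesis using False by simp
  next
    case True
    note P = pinv_full_column_rank[OF B True]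
    have M: "B * pinv B * C - C \<in> carrier_mat m q" using B C P(1) by auto
    have ker: "z \<in> mat_kernel (B * pinv B * C - C) \<longleftrightarrow> (\<exists>x \<in> carrier_vec p. B *\<^sub>v x = C *\<^sub>v z)"
      if z: "z \<in> carrier_vec q" for z
    proof -
      have "(B * pinv B * C - C) *\<^sub>v z = (B * pinv B * C) *\<^sub>v z - C *\<^sub>v z"
        using B C P(1) z by (intro minus_mult_distrib_mat_vec) auto
      also have "(B * pinv B * C) *\<^sub>v z = B *\<^sub>v (pinv B *\<^sub>v (C *\<^sub>v z))"
        using B C P(1) z by (simp add: assoc_mult_mat[of _ m p _ m _ q] assoc_mult_mat_vec[of _ m p _ q]
            assoc_mult_mat_vec[of _ p m _ q])
      finally have "z \<in> mat_kernel (B * pinv B * C - C) \<longleftrightarrow> B *\<^sub>v (pinv B *\<^sub>v (C *\<^sub>v z)) = C *\<^sub>v z"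
        unfolding mat_kernel[OF M] using z minus0 B C P(1) by simp
      moreover have "B *\<^sub>v (pinv B *\<^sub>v (C *\<^sub>v z)) = C *\<^sub>v z"
        if x: "x \<in> carrier_vec p" "B *\<^sub>v x = C *\<^sub>v z" for x
      proof -
        have "pinv B *\<^sub>v (B *\<^sub>v x) = x"
          using assoc_mult_mat_vec[OF P(1) B x(1)] P(2) x(1) by simp
        then show ?thesis using x(2) by simp
      qed
      moreover have "pinv B *\<^sub>v (C *\<^sub>v z) \<in> carrier_vec p" using P(1) C z by auto
      ultimately show ?thesis by blast
    qed
    have inj: "x = 0\<^sub>v p" if "x \<in> carrier_vec p" "B *\<^sub>v x = 0\<^sub>v m" for x
      using True full_column_rank_iff[OF B] that by blast
    have B0: "B *\<^sub>v 0\<^sub>v p = 0\<^sub>v m" by (rule mult_mat_zero_vec[OF B])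
    have C0: "C *\<^sub>v 0\<^sub>v q = 0\<^sub>v m" by (rule mult_mat_zero_vec[OF C])
    have k0: "0\<^sub>v q \<in> mat_kernel (B * pinv B * C - C)"
      using ker[of "0\<^sub>v q"] B0 C0 by (metis zero_carrier_vec)
    note z0 = k0 order_refl[of "0\<^sub>v q :: real vec"] B0 C0
    have "?l \<longleftrightarrow> (\<forall>z \<in> carrier_vec q. 0\<^sub>v q \<le> z \<longrightarrow> (\<exists>x \<in> carrier_vec p. B *\<^sub>v x = C *\<^sub>v z) \<longrightarrow> z = 0\<^sub>v q)"
    proof
      assume l: ?l
      show "\<forall>z \<in> carrier_vec q. 0\<^sub>v q \<le> z \<longrightarrow> (\<exists>x \<in> carrier_vec p. B *\<^sub>v x = C *\<^sub>v z) \<longrightarrow> z = 0\<^sub>v q"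
        using l eq by blast
    next
      assume r: "\<forall>z \<in> carrier_vec q. 0\<^sub>v q \<le> z \<longrightarrow> (\<exists>x \<in> carrier_vec p. B *\<^sub>v x = C *\<^sub>v z) \<longrightarrow> z = 0\<^sub>v q"
      show ?l
      proof (intro ballI iffI)
        fix x z :: "real vec" assume xz: "x \<in> carrier_vec p" "z \<in> carrier_vec q"
          and "B *\<^sub>v x - C *\<^sub>v z = 0\<^sub>v m \<and> 0\<^sub>v q \<le> z"
        then have "B *\<^sub>v x = C *\<^sub>v z" "z = 0\<^sub>v q" using r eq by blast+
        then show "x = 0\<^sub>v p \<and> z = 0\<^sub>v q" using inj xz z0(4) by simp
      next
        fix x z :: "real vec" assume xz: "x \<in> carrier_vec p" "z \<in> carrier_vec q"
          and "x = 0\<^sub>v p \<and> z = 0\<^sub>v q"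
        then show "B *\<^sub>v x - C *\<^sub>v z = 0\<^sub>v m \<and> 0\<^sub>v q \<le> z"
          using eq[OF xz] z0 by simp
      qed
    qed
    also have "\<dots> \<longleftrightarrow> ?k"
    proof
      assume "\<forall>z \<in> carrier_vec q. 0\<^sub>v q \<le> z \<longrightarrow> (\<exists>x \<in> carrier_vec p. B *\<^sub>v x = C *\<^sub>v z) \<longrightarrow> z = 0\<^sub>v q"
      then have "z \<in> {0\<^sub>v q}"
        if "z \<in> mat_kernel (B * pinv B * C - C) \<inter> {v \<in> carrier_vec q. 0\<^sub>v q \<le> v}" for z
        using that ker[of z] by simp
      then show ?k using z0(1,2) by (intro equalityI subsetI) simp_all
    next
      assume k: ?k
      show "\<forall>z \<in> carrier_vec q. 0\<^sub>v q \<le> z \<longrightarrow> (\<exists>x \<in> carrier_vec p. B *\<^sub>v x = C *\<^sub>v z) \<longrightarrow> z = 0\<^sub>v q"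
      proof (intro ballI impI)
        fix z assume z: "z \<in> carrier_vec q" "0\<^sub>v q \<le> z" "\<exists>x \<in> carrier_vec p. B *\<^sub>v x = C *\<^sub>v z"
        then have "z \<in> mat_kernel (B * pinv B * C - C) \<inter> {v \<in> carrier_vec q. 0\<^sub>v q \<le> v}"
          using ker[OF z(1)] by simp
        then show "z = 0\<^sub>v q" using k by simp
      qed
    qed
    finally show ?thesis using True by simp
  qed
qed

section \<open>Optimality and uniqueness of Lasso solutions\<close>

text \<open>The increment \<open>\<phi> t\<close> of a convex function satisfies \<open>\<phi> (s * t) \<le> s * \<phi> t\<close> for \<open>s\<close>
  between \<open>0\<close> and \<open>1\<close>, whereas the quadratic term scales with \<open>s\<^sup>2\<close> and is negligible for small \<open>s\<close>.\<close>

lemma convex_increment_nonneg: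
  fixes c g \<mu> x :: real
  assumes "\<mu> > 0" and *: "\<And>t. 0 \<le> c * t\<^sup>2 + (g * t + \<mu> * (\<bar>x + t\<bar> - \<bar>x\<bar>))"
  shows "0 \<le> g * t + \<mu> * (\<bar>x + t\<bar> - \<bar>x\<bar>)" (is "0 \<le> ?\<phi> t")
proof (rule ccontr)
  assume neg: "\<not> 0 \<le> ?\<phi> t"
  have lin: "0 \<le> s * (c * t\<^sup>2) + ?\<phi> t" if s: "0 < s" "s \<le> 1" for s
  proof -
    have "\<bar>x + s * t\<bar> = \<bar>s * (x + t) + (1 - s) * x\<bar>" by (simp add: algebra_simps)
    also have "\<dots> \<le> \<bar>s * (x + t)\<bar> + \<bar>(1 - s) * x\<bar>" by (rule abs_triangle_ineq)
    also have "\<dots> = s * \<bar>x + t\<bar> + (1 - s) * \<bar>x\<bar>" using s by (simp add: abs_mult)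
    finally have "\<bar>x + s * t\<bar> - \<bar>x\<bar> \<le> s * (\<bar>x + t\<bar> - \<bar>x\<bar>)" by (simp add: algebra_simps)
    then have "\<mu> * (\<bar>x + s * t\<bar> - \<bar>x\<bar>) \<le> \<mu> * (s * (\<bar>x + t\<bar> - \<bar>x\<bar>))"
      using \<open>\<mu> > 0\<close> by (simp add: mult_left_mono)
    then have "0 \<le> s * (s * (c * t\<^sup>2) + ?\<phi> t)"
      using *[of "s * t"] by (simp add: algebra_simps power2_eq_square)
    then show ?thesis using s by (simp add: zero_le_mult_iff)
  qed
  \<comment> \<open>Small enough to keep \<open>s * (c * t\<^sup>2)\<close> below half of the assumed deficit; the added \<open>1\<close>
    keeps the denominator positive.\<close>
  define s where "s = min 1 (- ?\<phi> t / (2 * (\<bar>c * t\<^sup>2\<bar> + 1)))"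
  have s: "0 < s" "s \<le> 1" using neg by (auto simp: s_def)
  have "s * (c * t\<^sup>2) \<le> s * (\<bar>c * t\<^sup>2\<bar> + 1)" using s by (intro mult_left_mono) auto
  also have "\<dots> \<le> - ?\<phi> t / (2 * (\<bar>c * t\<^sup>2\<bar> + 1)) * (\<bar>c * t\<^sup>2\<bar> + 1)"
    unfolding s_def by (intro mult_right_mono) auto
  also have "\<dots> = - ?\<phi> t / 2"
  proof -
    have "\<bar>c * t\<^sup>2\<bar> + 1 \<noteq> 0" by linarith
    then show ?thesis by (simp add: field_simps)
  qed
  finally have "s * (c * t\<^sup>2) \<le> - ?\<phi> t / 2" .
  then have "0 \<le> - ?\<phi> t / 2 + ?\<phi> t" using lin[OF s] by (rule order_trans[OF _ add_right_mono, rotated])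
  then have "0 \<le> ?\<phi> t / 2" by (smt (verit) field_sum_of_halves minus_divide_left)
  then show False using neg by simp
qed

lemma norm_2_squared: "(norm_2 v)\<^sup>2 = v \<bullet> v"
  by (simp add: norm_2_def scalar_prod_def sum_nonneg)

text \<open>The quadratic part is expanded exactly, so that the increment splits into the square of \<open>A h\<close> and a
  sum over coordinates. At an optimal point each of these parts is nonnegative (\<open>lasso_optimality\<close>).\<close>

lemma lasso_objective_add:
  assumes A: "A \<in> carrier_mat m n" and b: "b \<in> carrier_vec m"
    and x: "x \<in> carrier_vec n" and h: "h \<in> carrier_vec n"
  shows "lasso_objective A b \<mu> (x + h) = lasso_objective A b \<mu> x +
    1 / 2 * ((A *\<^sub>v h) \<bullet> (A *\<^sub>v h)) +
    (\<Sum>i<n. (A\<^sup>T *\<^sub>v (A *\<^sub>v x - b)) $ i * h $ i + \<mu> * (\<bar>x $ i + h $ i\<bar> - \<bar>x $ i\<bar>))"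
proof -
  define u where "u = A *\<^sub>v x - b"
  define w where "w = A *\<^sub>v h"
  have u: "u \<in> carrier_vec m" and w: "w \<in> carrier_vec m" using A b x h by (auto simp: u_def w_def)
  have e: "A *\<^sub>v (x + h) - b = u + w"
    unfolding u_def w_def mult_add_distrib_mat_vec[OF A x h] using A b x h
    by (intro eq_vecI) auto
  have "(u + w) \<bullet> (u + w) = u \<bullet> u + 2 * (u \<bullet> w) + w \<bullet> w"
    using u w by (simp add: add_scalar_prod_distrib[of _ m] scalar_prod_add_distrib[of _ m]
        comm_scalar_prod[of w m u])
  moreover have "u \<bullet> w = (\<Sum>i<n. (A\<^sup>T *\<^sub>v u) $ i * h $ i)"
    using transpose_vec_mult_scalar[OF A h u] h unfolding w_def
    by (simp add: scalar_prod_def lessThan_atLeast0)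
  moreover have "norm_1 (x + h) = norm_1 x + (\<Sum>i<n. \<bar>x $ i + h $ i\<bar> - \<bar>x $ i\<bar>)"
    using x h by (simp add: norm_1_def sum_subtractf)
  moreover have "1 / 2 * (a + 2 * s + w') + \<mu> * (n1 + d) = 1 / 2 * a + \<mu> * n1 + 1 / 2 * w' + (s + \<mu> * d)"
    for a s w' n1 d :: real
    by (simp add: algebra_simps add_divide_distrib)
  ultimately show ?thesis
    unfolding lasso_objective_def norm_2_squared e sum.distrib
    unfolding u_def[symmetric] w_def[symmetric]
    by (simp only: sum_distrib_left[symmetric])
qed

text \<open>Along the \<open>i\<close>-th axis the objective grows by a multiple of \<open>t\<^sup>2\<close> plus the \<open>i\<close>-th
  coordinate increment, so \<open>convex_increment_nonneg\<close> makes the latter nonnegative.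
  Steps of length \<open>1\<close> then bound the gradient, and the steps \<open>t = x\<^sub>i\<close> and \<open>t = - x\<^sub>i\<close> pin it down where \<open>x\<^sub>i\<close> is nonzero.\<close>

lemma lasso_optimality:
  assumes A: "A \<in> carrier_mat m n" and b: "b \<in> carrier_vec m" and mu: "\<mu> > 0"
    and opt: "x \<in> lasso_solutions A b \<mu>"
  defines "g \<equiv> A\<^sup>T *\<^sub>v (A *\<^sub>v x - b)"
  shows "x \<in> carrier_vec n"
    "\<And>i t. i < n \<Longrightarrow> 0 \<le> g $ i * t + \<mu> * (\<bar>x $ i + t\<bar> - \<bar>x $ i\<bar>)"
    "\<And>i. i < n \<Longrightarrow> \<bar>g $ i\<bar> \<le> \<mu>"
    "\<And>i. i < n \<Longrightarrow> x $ i \<noteq> 0 \<Longrightarrow> g $ i = - \<mu> * sgn (x $ i)"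
proof -
  show x: "x \<in> carrier_vec n" using opt A by (auto simp: lasso_solutions_def)
  show inc: "0 \<le> g $ i * t + \<mu> * (\<bar>x $ i + t\<bar> - \<bar>x $ i\<bar>)" if i: "i < n" for i t
  proof (rule convex_increment_nonneg[OF mu])
    fix t :: real
    define h where "h = t \<cdot>\<^sub>v (unit_vec n i :: real vec)"
    have h: "h \<in> carrier_vec n" by (simp add: h_def)
    define c where "c = 1 / 2 * ((A *\<^sub>v unit_vec n i) \<bullet> (A *\<^sub>v unit_vec n i))"
    have "A *\<^sub>v h = t \<cdot>\<^sub>v (A *\<^sub>v unit_vec n i)"
      unfolding h_def using A by (intro mult_mat_vec) auto
    then have Ah: "1 / 2 * ((A *\<^sub>v h) \<bullet> (A *\<^sub>v h)) = c * t\<^sup>2"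
      unfolding c_def using A by (simp add: power2_eq_square)
    have "(\<Sum>j<n. g $ j * h $ j + \<mu> * (\<bar>x $ j + h $ j\<bar> - \<bar>x $ j\<bar>)) =
      (\<Sum>j\<in>{i}. g $ j * h $ j + \<mu> * (\<bar>x $ j + h $ j\<bar> - \<bar>x $ j\<bar>))"
      using i by (intro sum.mono_neutral_right) (auto simp: h_def)
    then have S: "(\<Sum>j<n. g $ j * h $ j + \<mu> * (\<bar>x $ j + h $ j\<bar> - \<bar>x $ j\<bar>)) =
       g $ i * t + \<mu> * (\<bar>x $ i + t\<bar> - \<bar>x $ i\<bar>)" using i by (simp add: h_def)
    have "lasso_objective A b \<mu> x \<le> lasso_objective A b \<mu> (x + h)"
      using opt x h A by (auto simp: lasso_solutions_def)
    then show "0 \<le> c * t\<^sup>2 + (g $ i * t + \<mu> * (\<bar>x $ i + t\<bar> - \<bar>x $ i\<bar>))"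
      unfolding lasso_objective_add[OF A b x h] g_def[symmetric] Ah S by simp
  qed
  fix i assume i: "i < n"
  have "\<mu> * (\<bar>x $ i + 1\<bar> - \<bar>x $ i\<bar>) \<le> \<mu> * 1" "\<mu> * (\<bar>x $ i + (- 1)\<bar> - \<bar>x $ i\<bar>) \<le> \<mu> * 1"
    using mu by (intro mult_left_mono; simp)+
  then show "\<bar>g $ i\<bar> \<le> \<mu>" using inc[OF i, of 1] inc[OF i, of "-1"] by linarith
  assume nz: "x $ i \<noteq> 0"
  have "\<bar>x $ i + x $ i\<bar> - \<bar>x $ i\<bar> = \<bar>x $ i\<bar>" by simp
  then have "g $ i * x $ i = - \<mu> * \<bar>x $ i\<bar>"
    using inc[OF i, of "x $ i"] inc[OF i, of "- x $ i"] by simp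
  also have "\<dots> = (- \<mu> * sgn (x $ i)) * x $ i" by (simp add: abs_sgn)
  finally show "g $ i = - \<mu> * sgn (x $ i)" using nz by (simp only: mult_cancel_right) simp
qed

lemma lasso_solutions_add_iff:
  assumes A: "A \<in> carrier_mat m n" and b: "b \<in> carrier_vec m" and mu: "\<mu> > 0"
    and opt: "x \<in> lasso_solutions A b \<mu>" and h: "h \<in> carrier_vec n"
  defines "g \<equiv> A\<^sup>T *\<^sub>v (A *\<^sub>v x - b)"
  shows "x + h \<in> lasso_solutions A b \<mu> \<longleftrightarrow>
    A *\<^sub>v h = 0\<^sub>v m \<and> (\<forall>i<n. g $ i * h $ i + \<mu> * (\<bar>x $ i + h $ i\<bar> - \<bar>x $ i\<bar>) = 0)"
proof -
  note o = lasso_optimality[OF A b mu opt, folded g_def]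
  let ?q = "1 / 2 * ((A *\<^sub>v h) \<bullet> (A *\<^sub>v h))"
  let ?s = "\<Sum>i<n. g $ i * h $ i + \<mu> * (\<bar>x $ i + h $ i\<bar> - \<bar>x $ i\<bar>)"
  have obj: "lasso_objective A b \<mu> (x + h) = lasso_objective A b \<mu> x + ?q + ?s"
    unfolding lasso_objective_add[OF A b o(1) h] g_def ..
  have q: "0 \<le> ?q" by (simp add: scalar_prod_def sum_nonneg)
  have s: "0 \<le> ?s" using o(2) by (intro sum_nonneg) auto
  have "x + h \<in> lasso_solutions A b \<mu> \<longleftrightarrow> lasso_objective A b \<mu> (x + h) \<le> lasso_objective A b \<mu> x"
    using opt h A unfolding lasso_solutions_def by (auto intro: order_trans)
  also have "\<dots> \<longleftrightarrow> ?q = 0 \<and> ?s = 0" unfolding obj using q s by linarith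
  also have "?s = 0 \<longleftrightarrow> (\<forall>i<n. g $ i * h $ i + \<mu> * (\<bar>x $ i + h $ i\<bar> - \<bar>x $ i\<bar>) = 0)"
    using o(2) by (subst sum_nonneg_eq_0_iff) auto
  also have "?q = 0 \<longleftrightarrow> A *\<^sub>v h = 0\<^sub>v m"
    using scalar_prod_self_eq_0[of "A *\<^sub>v h"] A by simp
  finally show ?thesis .
qed

text \<open>Other solutions differ from \<open>x\<close> by a kernel vector \<open>h\<close> of \<open>A\<close> all of whose coordinate increments
  vanish. Where \<open>\<bar>g\<^sub>i\<bar> < \<mu>\<close> this forces \<open>h\<^sub>i = 0\<close>; where \<open>x\<^sub>i = 0\<close> and \<open>\<bar>g\<^sub>i\<bar> = \<mu>\<close> it says that
  \<open>h\<^sub>i\<close> does not have the sign of \<open>g\<^sub>i\<close>; where \<open>x\<^sub>i \<noteq> 0\<close> the increment is zero as long as \<open>h\<^sub>i\<close> does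
  not flip the sign of \<open>x\<^sub>i\<close>. The last restriction disappears after scaling \<open>h\<close> by a small positive
  factor, which leaves a condition that is homogeneous in \<open>h\<close>.\<close>

lemma lasso_unique_iff_direction:
  assumes A: "A \<in> carrier_mat m n" and b: "b \<in> carrier_vec m" and mu: "\<mu> > 0"
    and opt: "x \<in> lasso_solutions A b \<mu>"
  defines "g \<equiv> A\<^sup>T *\<^sub>v (A *\<^sub>v x - b)"
  shows "lasso_solutions A b \<mu> = {x} \<longleftrightarrow>
    (\<forall>h \<in> carrier_vec n. A *\<^sub>v h = 0\<^sub>v m \<and> (\<forall>i<n. \<bar>g $ i\<bar> \<noteq> \<mu> \<longrightarrow> h $ i = 0) \<and>
      (\<forall>i<n. x $ i = 0 \<longrightarrow> g $ i * h $ i \<le> 0) \<longrightarrow> h = 0\<^sub>v n)" (is "?l \<longleftrightarrow> ?r")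
proof
  note o = lasso_optimality[OF A b mu opt, folded g_def]
  note add_iff = lasso_solutions_add_iff[OF A b mu opt, folded g_def]
  assume l: ?l
  show ?r
  proof (intro ballI impI, elim conjE)
    fix h assume h: "h \<in> carrier_vec n" and Ah: "A *\<^sub>v h = 0\<^sub>v m"
      and off: "\<forall>i<n. \<bar>g $ i\<bar> \<noteq> \<mu> \<longrightarrow> h $ i = 0" and sg: "\<forall>i<n. x $ i = 0 \<longrightarrow> g $ i * h $ i \<le> 0"
    \<comment> \<open>Small enough that no nonzero coordinate of \<open>x\<close> changes its sign; coordinates with
      \<open>x\<^sub>i = 0\<close> contribute nothing, because division by zero gives zero.\<close>
    define t where "t = 1 / (1 + (\<Sum>i<n. \<bar>h $ i\<bar> / \<bar>x $ i\<bar>))"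
    have den: "1 + (\<Sum>i<n. \<bar>h $ i\<bar> / \<bar>x $ i\<bar>) > 0"
      by (intro add_pos_nonneg sum_nonneg) auto
    then have t: "t > 0" by (simp add: t_def)
    have small: "t * \<bar>h $ i\<bar> \<le> \<bar>x $ i\<bar>" if "i < n" "x $ i \<noteq> 0" for i
    proof -
      have "\<bar>h $ i\<bar> / \<bar>x $ i\<bar> \<le> (\<Sum>i<n. \<bar>h $ i\<bar> / \<bar>x $ i\<bar>)"
        using that by (intro member_le_sum) auto
      then have "\<bar>h $ i\<bar> / \<bar>x $ i\<bar> \<le> 1 + (\<Sum>i<n. \<bar>h $ i\<bar> / \<bar>x $ i\<bar>)" by simp
      then show ?thesis using that den by (simp add: t_def field_simps)
    qed
    have th: "t \<cdot>\<^sub>v h \<in> carrier_vec n" using h by simp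
    have "x + t \<cdot>\<^sub>v h \<in> lasso_solutions A b \<mu>"
      unfolding add_iff[OF th]
    proof (intro conjI allI impI)
      show "A *\<^sub>v (t \<cdot>\<^sub>v h) = 0\<^sub>v m" unfolding mult_mat_vec[OF A h] Ah by (intro eq_vecI) simp_all
      fix i assume i: "i < n"
      have "g $ i * (t * h $ i) + \<mu> * (\<bar>x $ i + t * h $ i\<bar> - \<bar>x $ i\<bar>) = 0"
      proof (cases "x $ i = 0")
        case False
        have "\<bar>t * h $ i\<bar> \<le> \<bar>x $ i\<bar>" using small[OF i False] t by (simp add: abs_mult)
        then have "\<bar>x $ i + t * h $ i\<bar> - \<bar>x $ i\<bar> = sgn (x $ i) * (t * h $ i)"
          using False by (cases "x $ i > 0") auto
        then show ?thesis using o(4)[OF i False] by simp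
      next
        case True
        show ?thesis
        proof (cases "\<bar>g $ i\<bar> = \<mu>")
          case False
          then show ?thesis using off i True by simp
        next
          case g: True
          have "\<mu> * \<bar>h $ i\<bar> = \<bar>g $ i * h $ i\<bar>" using g by (simp add: abs_mult)
          also have "\<dots> = - (g $ i * h $ i)" using sg i True by simp
          finally have "t * (g $ i * h $ i + \<mu> * \<bar>h $ i\<bar>) = 0" by simp
          then show ?thesis using True t by (simp add: abs_mult algebra_simps)
        qed
      qed
      then show "g $ i * (t \<cdot>\<^sub>v h) $ i + \<mu> * (\<bar>x $ i + (t \<cdot>\<^sub>v h) $ i\<bar> - \<bar>x $ i\<bar>) = 0"
        using h i by simp
    qed
    then have e: "x + t \<cdot>\<^sub>v h = x" using l by blast
    have "h $ i = 0" if i: "i < n" for i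
    proof -
      have "(x + t \<cdot>\<^sub>v h) $ i = x $ i" using e by simp
      then show ?thesis using t i h o(1) by simp
    qed
    then show "h = 0\<^sub>v n" using h by (intro eq_vecI) auto
  qed
next
  note o = lasso_optimality[OF A b mu opt, folded g_def]
  note add_iff = lasso_solutions_add_iff[OF A b mu opt, folded g_def]
  assume r: ?r
  have "x' = x" if x': "x' \<in> lasso_solutions A b \<mu>" for x'
  proof -
    define h where "h = x' - x"
    have xc: "x' \<in> carrier_vec n" using x' A by (auto simp: lasso_solutions_def)
    then have h: "h \<in> carrier_vec n" using o(1) by (simp add: h_def)
    have xh: "x + h = x'" using xc o(1) by (intro eq_vecI) (auto simp: h_def)
    then have Ah: "A *\<^sub>v h = 0\<^sub>v m"
      and z: "\<And>i. i < n \<Longrightarrow> g $ i * h $ i + \<mu> * (\<bar>x $ i + h $ i\<bar> - \<bar>x $ i\<bar>) = 0"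
      using add_iff[OF h] x' by auto
    have "\<forall>i<n. x $ i = 0 \<longrightarrow> g $ i * h $ i \<le> 0"
    proof (intro allI impI)
      fix i assume "i < n" "x $ i = 0"
      then have "g $ i * h $ i = - (\<mu> * \<bar>h $ i\<bar>)" using z[of i] by simp
      then show "g $ i * h $ i \<le> 0" using mu by simp
    qed
    moreover have "\<forall>i<n. \<bar>g $ i\<bar> \<noteq> \<mu> \<longrightarrow> h $ i = 0"
    proof (intro allI impI, rule ccontr)
      fix i assume i: "i < n" "\<bar>g $ i\<bar> \<noteq> \<mu>" "h $ i \<noteq> 0"
      have "x $ i = 0"
      proof (rule ccontr)
        assume "x $ i \<noteq> 0"
        then have "\<bar>g $ i\<bar> = \<mu>" using o(4)[OF i(1)] mu by (simp add: abs_mult abs_sgn_eq)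
        then show False using i by simp
      qed
      then have "\<mu> * \<bar>h $ i\<bar> = - (g $ i * h $ i)" using z[OF i(1)] by simp
      also have "\<dots> \<le> \<bar>g $ i\<bar> * \<bar>h $ i\<bar>" by (metis abs_ge_minus_self abs_mult)
      finally have "\<mu> \<le> \<bar>g $ i\<bar>" using i(3) by simp
      then show False using o(3)[OF i(1)] i(2) by simp
    qed
    ultimately have "h = 0\<^sub>v n" using r h Ah by blast
    then show ?thesis using xh o(1) by simp
  qed
  then show ?l using opt by blast
qed

section \<open>Vectors and matrices indexed by a set of columns\<close>

text \<open>Extension by zero from \<open>I\<close>-indexed vectors to \<open>\<real>\<^sup>n\<close>: the element \<open>j\<close> of \<open>I\<close> has
  the position \<open>card {a \<in> I. a < j}\<close>, which inverts \<^const>\<open>pick\<close>.\<close>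

definition spread :: "nat \<Rightarrow> nat set \<Rightarrow> real vec \<Rightarrow> real vec" where
  "spread n I v = vec n (\<lambda>j. if j \<in> I then v $ card {a \<in> I. a < j} else 0)"

lemma pick_index:
  assumes I: "I \<subseteq> {..<n}"
  shows "i < card I \<Longrightarrow> pick I i \<in> I"
    and "i < card I \<Longrightarrow> card {a \<in> I. a < pick I i} = i"
    and "j \<in> I \<Longrightarrow> card {a \<in> I. a < j} < card I"
    and "bij_betw (pick I) {..<card I} I"
proof -
  have fin: "finite I" using I finite_subset by blast
  show 1: "pick I i \<in> I" if "i < card I" for i using that by (intro pick_in_set) simp
  show 2: "card {a \<in> I. a < pick I i} = i" if "i < card I" for i using that by (intro card_pick) simp
  show 3: "card {a \<in> I. a < j} < card I" if "j \<in> I" for j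
    using that fin by (intro psubset_card_mono) auto
  show "bij_betw (pick I) {..<card I} I"
    by (rule bij_betw_byWitness[where f' = "\<lambda>j. card {a \<in> I. a < j}"])
       (auto simp: 1 2 3 pick_card_in_set)
qed

lemma restrict_index_set: "I \<subseteq> {..<n} \<Longrightarrow> {i. i < n \<and> i \<in> I} = I"
  by auto

lemma spread_carrier [simp]: "spread n I v \<in> carrier_vec n"
  by (simp add: spread_def)

lemma dim_spread [simp]: "dim_vec (spread n I v) = n"
  by (simp add: spread_def)

lemma spread_pick:
  assumes "I \<subseteq> {..<n}" "i < card I"
  shows "spread n I v $ pick I i = v $ i"
proof -
  have "pick I i \<in> I" using pick_index(1)[OF assms] .
  then show ?thesis using pick_index(2)[OF assms] assms(1) by (simp add: spread_def subset_iff)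
qed

lemma spread_outside: "j < n \<Longrightarrow> j \<notin> I \<Longrightarrow> spread n I v $ j = 0"
  by (simp add: spread_def)

lemma spread_inside:
  assumes "I \<subseteq> {..<n}" "j \<in> I" "\<And>i. i < card I \<Longrightarrow> v $ i = w (pick I i)"
  shows "spread n I v $ j = w j"
  using assms(2) pick_index(3)[OF assms(1,2)] assms(1)
  by (auto simp: spread_def assms(3) pick_card_in_set)

lemma cols_sub_carrier:
  assumes "A \<in> carrier_mat m n" "I \<subseteq> {..<n}"
  shows "cols_sub A I \<in> carrier_mat m (card I)"
  using assms(1) restrict_index_set[OF assms(2)]
  by (intro carrier_matI) (simp_all add: cols_sub_def dim_submatrix)

lemma cols_sub_index:
  assumes "A \<in> carrier_mat m n" "I \<subseteq> {..<n}" "r < m" "i < card I"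
  shows "cols_sub A I $$ (r, i) = A $$ (r, pick I i)"
  using assms restrict_index_set[OF assms(2)]
  by (simp add: cols_sub_def submatrix_index pick_UNIV)

text \<open>This turns products with column submatrices into products with \<open>A\<close> itself, so that the parts
  belonging to disjoint index sets can be added up in \<open>\<real>\<^sup>n\<close>.\<close>

lemma cols_sub_mult_vec:
  fixes A :: "real mat"
  assumes A: "A \<in> carrier_mat m n" and I: "I \<subseteq> {..<n}" and v: "v \<in> carrier_vec (card I)"
  shows "cols_sub A I *\<^sub>v v = A *\<^sub>v spread n I v"
proof (rule eq_vecI)
  note C = cols_sub_carrier[OF A I]
  fix r assume "r < dim_vec (A *\<^sub>v spread n I v)"
  then have r: "r < m" using A by simp
  have "(cols_sub A I *\<^sub>v v) $ r = (\<Sum>i<card I. cols_sub A I $$ (r, i) * v $ i)"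
    using C r v by (simp add: scalar_prod_def lessThan_atLeast0)
  also have "\<dots> = (\<Sum>i<card I. A $$ (r, pick I i) * spread n I v $ pick I i)"
    by (intro sum.cong) (simp_all add: cols_sub_index[OF A I r] spread_pick[OF I])
  also have "\<dots> = (\<Sum>j\<in>I. A $$ (r, j) * spread n I v $ j)"
    using pick_index(4)[OF I] by (rule sum.reindex_bij_betw)
  also have "\<dots> = (\<Sum>j<n. A $$ (r, j) * spread n I v $ j)"
    using I by (intro sum.mono_neutral_left) (auto simp: spread_outside)
  also have "\<dots> = (A *\<^sub>v spread n I v) $ r"
    using A r by (simp add: scalar_prod_def lessThan_atLeast0 spread_def)
  finally show "(cols_sub A I *\<^sub>v v) $ r = (A *\<^sub>v spread n I v) $ r" .
qed (use cols_sub_carrier[OF A I] A in auto)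

lemma spread_subvec:
  assumes I: "I \<subseteq> {..<n}" and x: "x \<in> carrier_vec n" "\<And>j. j < n \<Longrightarrow> j \<notin> I \<Longrightarrow> x $ j = 0"
  shows "spread n I (subvec x I) = x"
proof (rule eq_vecI)
  fix j assume "j < dim_vec x"
  then have j: "j < n" using x by simp
  have sub: "subvec x I $ i = x $ pick I i" if "i < card I" for i
    using that x(1) restrict_index_set[OF I] by (simp add: subvec_def)
  show "spread n I (subvec x I) $ j = x $ j"
  proof (cases "j \<in> I")
    case True
    show ?thesis by (rule spread_inside[OF I True sub])
  next
    case False
    then show ?thesis using spread_outside[OF j] x(2)[OF j] by simp
  qed
qed (use x in \<open>auto simp: spread_def\<close>)

lemma subvec_carrier:
  assumes "I \<subseteq> {..<n}" "x \<in> carrier_vec n"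
  shows "subvec x I \<in> carrier_vec (card I)"
  using assms(2) restrict_index_set[OF assms(1)] by (intro carrier_vecI) (simp add: subvec_def)

lemma Diag_mult_vec:
  assumes "v \<in> carrier_vec (dim_vec d)"
  shows "Diag d *\<^sub>v v = vec (dim_vec d) (\<lambda>i. d $ i * v $ i)"
proof (rule eq_vecI)
  fix i assume "i < dim_vec (vec (dim_vec d) (\<lambda>i. d $ i * v $ i))"
  then have i: "i < dim_vec d" by simp
  have "(Diag d *\<^sub>v v) $ i = (\<Sum>j\<in>{0..<dim_vec d}. (if i = j then d $ j else 0) * v $ j)"
    using i assms by (simp add: Diag_def mat_diag_def scalar_prod_def)
  also have "\<dots> = (\<Sum>j\<in>{i}. (if i = j then d $ j else 0) * v $ j)"
    using i by (intro sum.mono_neutral_right) auto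
  finally show "(Diag d *\<^sub>v v) $ i = vec (dim_vec d) (\<lambda>i. d $ i * v $ i) $ i" using i by simp
qed (simp add: Diag_def mat_diag_def)

lemma Diag_carrier: "Diag d \<in> carrier_mat (dim_vec d) (dim_vec d)"
  by (simp add: Diag_def)

lemma Diag_transpose: "(Diag d)\<^sup>T = Diag d"
  by (rule eq_matI) (auto simp: Diag_def mat_diag_def)

lemma cols_sub_transpose_mult_vec:
  fixes A :: "real mat"
  assumes A: "A \<in> carrier_mat m n" and I: "I \<subseteq> {..<n}" and w: "w \<in> carrier_vec m" and i: "i < card I"
  shows "((cols_sub A I)\<^sup>T *\<^sub>v w) $ i = (A\<^sup>T *\<^sub>v w) $ pick I i"
proof -
  have p: "pick I i < n" using pick_index(1)[OF I i] I by auto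
  show ?thesis
    using cols_sub_carrier[OF A I] A w i p
    by (auto simp: scalar_prod_def cols_sub_index[OF A I] intro!: sum.cong)
qed

text \<open>Directions supported on \<open>J \<union> K\<close> are the vectors \<open>h\<close> with \<open>h\<^sub>J = x\<close> and \<open>h\<^sub>K = - Q z\<close>, where
  \<open>Q\<close> carries the signs of \<open>g\<close> on \<open>K\<close>. As \<open>Q\<close> is its own inverse, this is a bijection between
  directions and pairs \<open>(x, z)\<close>. It turns \<open>A h\<close> into \<open>A\<^sub>J x - A\<^sub>K Q z\<close> and \<open>g\<^sub>i h\<^sub>i \<le> 0\<close> into \<open>z \<ge> 0\<close>.\<close>

lemma direction_iff_signed_system:
  fixes A :: "real mat" and g :: "nat \<Rightarrow> real"
  assumes A: "A \<in> carrier_mat m n" and J: "J \<subseteq> {..<n}" and K: "K \<subseteq> {..<n}" and JK: "J \<inter> K = {}"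
    and g: "\<And>j. j \<in> K \<Longrightarrow> g j \<noteq> 0"
    and d: "dim_vec d = card K" "\<And>i. i < card K \<Longrightarrow> d $ i = sgn (g (pick K i))"
  shows "(\<forall>h \<in> carrier_vec n. A *\<^sub>v h = 0\<^sub>v m \<and> (\<forall>i<n. i \<notin> J \<union> K \<longrightarrow> h $ i = 0) \<and>
      (\<forall>i\<in>K. g i * h $ i \<le> 0) \<longrightarrow> h = 0\<^sub>v n) \<longleftrightarrow>
    (\<forall>x \<in> carrier_vec (card J). \<forall>z \<in> carrier_vec (card K).
       (cols_sub A J *\<^sub>v x - (cols_sub A K * Diag d) *\<^sub>v z = 0\<^sub>v m \<and> 0\<^sub>v (card K) \<le> z)
          \<longleftrightarrow> (x = 0\<^sub>v (card J) \<and> z = 0\<^sub>v (card K)))" (is "?l \<longleftrightarrow> ?r")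
proof -
  define h where "h x z = spread n J x - spread n K (Diag d *\<^sub>v z)" for x z
  have D: "Diag d \<in> carrier_mat (card K) (card K)" using Diag_carrier[of d] d by simp
  have hc: "h x z \<in> carrier_vec n" for x z by (simp add: h_def)
  have Ah: "A *\<^sub>v h x z = cols_sub A J *\<^sub>v x - (cols_sub A K * Diag d) *\<^sub>v z"
    if "x \<in> carrier_vec (card J)" "z \<in> carrier_vec (card K)" for x z
    unfolding h_def using that A D
    by (simp add: mult_minus_distrib_mat_vec[OF A] cols_sub_mult_vec[OF A J] cols_sub_mult_vec[OF A K]
        assoc_mult_mat_vec[OF cols_sub_carrier[OF A K] D])
  have hJ: "h x z $ pick J i = x $ i" if "i < card J" for x z i
  proof -
    have "pick J i \<in> J" using pick_index(1)[OF J that] .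
    moreover from this have "pick J i < n" "pick J i \<notin> K" using J JK by auto
    ultimately show ?thesis using that
      by (simp add: h_def spread_pick[OF J] spread_outside)
  qed
  have hK: "h x z $ pick K i = - sgn (g (pick K i)) * z $ i"
    if "i < card K" "z \<in> carrier_vec (card K)" for x z i
  proof -
    have "pick K i \<in> K" using pick_index(1)[OF K that(1)] .
    moreover from this have "pick K i < n" "pick K i \<notin> J" using K JK by auto
    ultimately show ?thesis using that d
      by (simp add: h_def spread_pick[OF K] spread_outside Diag_mult_vec)
  qed
  have hE: "h x z $ j = 0" if "j < n" "j \<notin> J \<union> K" for x z j
    using that by (simp add: h_def spread_outside)
  have sg: "sgn (g (pick K i)) \<noteq> 0" "sgn (g (pick K i)) * sgn (g (pick K i)) = 1" if "i < card K" for i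
    using g[OF pick_index(1)[OF K that]] by (auto simp: sgn_real_def)
  have Kpick: "\<exists>i<card K. j = pick K i" if "j \<in> K" for j
    using that pick_index(3)[OF K that] pick_card_in_set[OF that] by metis
  show ?thesis
  proof
    assume l: ?l
    show ?r
    proof (intro ballI iffI)
      fix x z :: "real vec"
      assume x: "x \<in> carrier_vec (card J)" and z: "z \<in> carrier_vec (card K)"
      assume *: "cols_sub A J *\<^sub>v x - (cols_sub A K * Diag d) *\<^sub>v z = 0\<^sub>v m \<and> 0\<^sub>v (card K) \<le> z"
      have "\<forall>j\<in>K. g j * h x z $ j \<le> 0"
      proof
        fix j assume "j \<in> K"
        then obtain i where i: "i < card K" "j = pick K i" using Kpick by blast
        have "0 \<le> z $ i" using * z i by (auto simp: less_eq_vec_def)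
        then have "0 \<le> \<bar>g j\<bar> * z $ i" by simp
        then show "g j * h x z $ j \<le> 0" using hK[OF i(1) z] i(2) by (simp add: abs_sgn mult.assoc)
      qed
      then have h0: "h x z = 0\<^sub>v n" using l hc hE Ah[OF x z] * by simp
      have "x $ i = 0" if "i < card J" for i
        using hJ[OF that, of x z] h0 pick_index(1)[OF J that] J by (auto simp: subset_iff)
      moreover have "z $ i = 0" if "i < card K" for i
      proof -
        have "pick K i < n" using pick_index(1)[OF K that] K by auto
        then have "sgn (g (pick K i)) * z $ i = 0" using hK[OF that z, of x] h0 by simp
        then show ?thesis using sg(1)[OF that] by simp
      qed
      ultimately show "x = 0\<^sub>v (card J) \<and> z = 0\<^sub>v (card K)" using x z by (auto simp: vec_eq_iff)
    next
      fix x z :: "real vec"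
      assume x: "x \<in> carrier_vec (card J)" and z: "z \<in> carrier_vec (card K)"
      assume *: "x = 0\<^sub>v (card J) \<and> z = 0\<^sub>v (card K)"
      have "cols_sub A J *\<^sub>v 0\<^sub>v (card J) = 0\<^sub>v m" by (rule mult_mat_zero_vec[OF cols_sub_carrier[OF A J]])
      moreover have "(cols_sub A K * Diag d) *\<^sub>v 0\<^sub>v (card K) = 0\<^sub>v m"
        by (rule mult_mat_zero_vec[OF mult_carrier_mat[OF cols_sub_carrier[OF A K] D]])
      ultimately show "cols_sub A J *\<^sub>v x - (cols_sub A K * Diag d) *\<^sub>v z = 0\<^sub>v m \<and> 0\<^sub>v (card K) \<le> z"
        using * by simp
    qed
  next
    assume r: ?r
    show ?l
    proof (intro ballI impI, elim conjE)
      fix y :: "real vec"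
      assume y: "y \<in> carrier_vec n" "A *\<^sub>v y = 0\<^sub>v m" "\<forall>i<n. i \<notin> J \<union> K \<longrightarrow> y $ i = 0"
        "\<forall>i\<in>K. g i * y $ i \<le> 0"
      define x where "x = vec (card J) (\<lambda>i. y $ pick J i)"
      define z where "z = vec (card K) (\<lambda>i. - sgn (g (pick K i)) * y $ pick K i)"
      have x: "x \<in> carrier_vec (card J)" and z: "z \<in> carrier_vec (card K)" by (simp_all add: x_def z_def)
      have yh: "h x z = y"
      proof (rule eq_vecI)
        fix j assume "j < dim_vec y"
        then have j: "j < n" using y(1) by simp
        consider "j \<in> J" | "j \<in> K" | "j \<notin> J \<union> K" by blast
        then show "h x z $ j = y $ j"
        proof cases
          case 1
          then show ?thesis
            using hJ[OF pick_index(3)[OF J 1], of x z] pick_index(3)[OF J 1]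
            by (simp add: pick_card_in_set x_def)
        next
          case 2
          then obtain i where i: "i < card K" "j = pick K i" using Kpick by blast
          then show ?thesis using hK[OF i(1) z, of x] sg(2)[OF i(1)]
            by (simp add: z_def flip: mult.assoc)
        next
          case 3
          then show ?thesis using hE[OF j] y(3) j by simp
        qed
      qed (use hc[of x z] y in auto)
      have "0 \<le> z $ i" if i: "i < card K" for i
      proof -
        have "g (pick K i) * y $ pick K i \<le> 0" using y(4) pick_index(1)[OF K i] by blast
        then have "sgn (g (pick K i)) * y $ pick K i \<le> 0"
          using sg(1)[OF i] by (auto simp: sgn_real_def mult_le_0_iff split: if_splits)
        then show ?thesis using i by (simp add: z_def)
      qed
      then have "0\<^sub>v (card K) \<le> z" using z by (auto simp: less_eq_vec_def)
      moreover have "cols_sub A J *\<^sub>v x - (cols_sub A K * Diag d) *\<^sub>v z = 0\<^sub>v m"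
        using Ah[OF x z] yh y(2) by simp
      ultimately have "x = 0\<^sub>v (card J)" "z = 0\<^sub>v (card K)" using r x z by blast+
      moreover have "spread n J (0\<^sub>v (card J)) = 0\<^sub>v n" "spread n K (0\<^sub>v (card K)) = 0\<^sub>v n"
        using pick_index(3)[OF J] pick_index(3)[OF K] by (auto simp: spread_def vec_eq_iff)
      moreover have "Diag d *\<^sub>v 0\<^sub>v (card K) = 0\<^sub>v (card K)" by (rule mult_mat_zero_vec[OF D])
      ultimately show "y = 0\<^sub>v n" unfolding yh[symmetric] h_def by simp
    qed
  qed
qed

section \<open>Characterization of unique Lasso solutions\<close>

theorem theorem6p1:
  fixes m n :: nat and A :: "real mat" and b xs :: "real vec" and \<mu> :: real
    and E J K :: "nat set" and AJ AK QK :: "real mat"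
  assumes A: "A \<in> carrier_mat m n"
    and b: "b \<in> carrier_vec m"
    and mu: "\<mu> > 0"
    and opt: "xs \<in> lasso_solutions A b \<mu>"
    and E: "E = {j. j < n \<and> \<bar>(A\<^sup>T *\<^sub>v (A *\<^sub>v xs - b)) $ j\<bar> = \<mu>}"
    and K: "K = {j \<in> E. xs $ j = 0}"
    and J: "J = E - K"
    and AJ: "AJ = cols_sub A J"
    and AK: "AK = cols_sub A K"
    and QK: "QK = Diag (sign_vec (AK\<^sup>T *\<^sub>v (AJ *\<^sub>v subvec xs J - b)))"
  shows
    "(lasso_solutions A b \<mu> = {xs} \<longleftrightarrow>
        (\<forall>xJ \<in> carrier_vec (card J). \<forall>xK \<in> carrier_vec (card K).
          (AJ *\<^sub>v xJ - (AK * QK) *\<^sub>v xK = 0\<^sub>v m \<and> 0\<^sub>v (card K) \<le> xK)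
            \<longleftrightarrow> (xJ = 0\<^sub>v (card J) \<and> xK = 0\<^sub>v (card K)))) \<and>
     (lasso_solutions A b \<mu> = {xs} \<longleftrightarrow>
        (full_column_rank AJ \<and>
         mat_kernel (AJ * pinv AJ * AK * QK - AK * QK) \<inter> {v \<in> carrier_vec (card K). 0\<^sub>v (card K) \<le> v}
           = {0\<^sub>v (card K)})) \<and>
     (lasso_solutions A b \<mu> = {xs} \<longleftrightarrow>
        (full_column_rank AJ \<and>
         (\<exists>y \<in> carrier_vec m. \<forall>i < card K.
           ((QK * AK\<^sup>T * AJ * pinv AJ - QK * AK\<^sup>T) *\<^sub>v y) $ i < 0)))"
proof -
  define g where "g = A\<^sup>T *\<^sub>v (A *\<^sub>v xs - b)"
  note o = lasso_optimality[OF A b mu opt, folded g_def]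
  have E': "E = {j. j < n \<and> \<bar>g $ j\<bar> = \<mu>}" by (simp add: E g_def)
  have sub: "J \<subseteq> {..<n}" "K \<subseteq> {..<n}" "J \<inter> K = {}" and JK: "J \<union> K = E"
    using E' K J by auto
  note AJc = cols_sub_carrier[OF A sub(1), folded AJ] and AKc = cols_sub_carrier[OF A sub(2), folded AK]
  \<comment> \<open>Optimality puts the support of \<open>xs\<close> inside \<open>E\<close>, so \<open>J\<close> is the whole support. Hence the residual
    in the definition of \<open>QK\<close> is that of \<open>xs\<close>, and \<open>QK\<close> holds the signs of the gradient on \<open>K\<close>.\<close>
  have "xs $ j = 0" if "j < n" "j \<notin> J" for j
  proof (rule ccontr)
    assume nz: "xs $ j \<noteq> 0"
    then have "\<bar>g $ j\<bar> = \<mu>" using o(4)[OF that(1)] mu by (simp add: abs_mult abs_sgn_eq)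
    then show False using that nz E' K J by simp
  qed
  then have AJx: "AJ *\<^sub>v subvec xs J = A *\<^sub>v xs"
    unfolding AJ cols_sub_mult_vec[OF A sub(1) subvec_carrier[OF sub(1) o(1)]]
    using spread_subvec[OF sub(1) o(1)] by simp
  define d where "d = sign_vec (AK\<^sup>T *\<^sub>v (A *\<^sub>v xs - b))"
  have QK': "QK = Diag d" unfolding QK AJx d_def ..
  have dim_d: "dim_vec d = card K" using AKc by (simp add: d_def sign_vec_def)
  have w: "A *\<^sub>v xs - b \<in> carrier_vec m" using A b by (intro carrier_vecI) simp
  have d: "d $ i = sgn (g $ pick K i)" if "i < card K" for i
    using cols_sub_transpose_mult_vec[OF A sub(2) w that, folded AK] A b AKc that
    by (simp add: d_def sign_vec_def g_def)
  have QKc: "QK \<in> carrier_mat (card K) (card K)" using Diag_carrier[of d] dim_d QK' by simp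
  have gK: "g $ j \<noteq> 0" if "j \<in> K" for j using that K E' mu by auto
  have "lasso_solutions A b \<mu> = {xs} \<longleftrightarrow>
    (\<forall>h \<in> carrier_vec n. A *\<^sub>v h = 0\<^sub>v m \<and> (\<forall>i<n. i \<notin> J \<union> K \<longrightarrow> h $ i = 0) \<and>
      (\<forall>i\<in>K. g $ i * h $ i \<le> 0) \<longrightarrow> h = 0\<^sub>v n)"
  proof -
    have "(\<forall>i<n. \<bar>g $ i\<bar> \<noteq> \<mu> \<longrightarrow> h $ i = 0) \<and> (\<forall>i<n. xs $ i = 0 \<longrightarrow> g $ i * h $ i \<le> 0) \<longleftrightarrow>
      (\<forall>i<n. i \<notin> J \<union> K \<longrightarrow> h $ i = 0) \<and> (\<forall>i\<in>K. g $ i * h $ i \<le> 0)" for h :: "real vec"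
      unfolding JK unfolding K E' by force
    then show ?thesis
      unfolding lasso_unique_iff_direction[OF A b mu opt] g_def[symmetric] by simp
  qed
  also have "\<dots> \<longleftrightarrow> (\<forall>xJ \<in> carrier_vec (card J). \<forall>xK \<in> carrier_vec (card K).
          (AJ *\<^sub>v xJ - (AK * QK) *\<^sub>v xK = 0\<^sub>v m \<and> 0\<^sub>v (card K) \<le> xK)
            \<longleftrightarrow> (xJ = 0\<^sub>v (card J) \<and> xK = 0\<^sub>v (card K)))"
    unfolding AJ AK QK' by (rule direction_iff_signed_system[OF A sub gK dim_d d])
  finally have i_ii: "lasso_solutions A b \<mu> = {xs} \<longleftrightarrow> \<dots>" .
  have CQ: "AK * QK \<in> carrier_mat m (card K)" using AKc QKc by simp
  note ii_iii = trivial_cone_kernel_iff[OF AJc CQ]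
  \<comment> \<open>Reassociating needs \<open>pinv AJ\<close> to have the right dimensions, which is known only if \<open>AJ\<close> has full
    column rank.\<close>
  have assoc: "AJ * pinv AJ * (AK * QK) = AJ * pinv AJ * AK * QK" if "full_column_rank AJ"
    using pinv_full_column_rank(1)[OF AJc that] AJc AKc QKc
    by (subst assoc_mult_mat[of "AJ * pinv AJ" m m AK "card K" QK "card K"]) auto
  have i_iii: "lasso_solutions A b \<mu> = {xs} \<longleftrightarrow> (full_column_rank AJ \<and>
         mat_kernel (AJ * pinv AJ * AK * QK - AK * QK) \<inter> {v \<in> carrier_vec (card K). 0\<^sub>v (card K) \<le> v}
           = {0\<^sub>v (card K)})"
  proof (cases "full_column_rank AJ")
    case True
    then show ?thesis unfolding i_ii ii_iii assoc[OF True] by blast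
  next
    case False
    then show ?thesis unfolding i_ii ii_iii by (simp only: simp_thms)
  qed
  \<comment> \<open>The matrices in the last two conditions are transposes of each other, because \<open>QK\<close> and the
    projection \<open>AJ * pinv AJ\<close> are symmetric; so Gordan's theorem links them.\<close>
  have "mat_kernel (AJ * pinv AJ * AK * QK - AK * QK) \<inter> {v \<in> carrier_vec (card K). 0\<^sub>v (card K) \<le> v}
           = {0\<^sub>v (card K)} \<longleftrightarrow> (\<exists>y \<in> carrier_vec m. \<forall>i < card K.
           ((QK * AK\<^sup>T * AJ * pinv AJ - QK * AK\<^sup>T) *\<^sub>v y) $ i < 0)" if fr: "full_column_rank AJ"
  proof -
    note P = pinv_full_column_rank[OF AJc fr]
    have Pc: "AJ * pinv AJ \<in> carrier_mat m m" using AJc P(1) by simp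
    have QT: "QK\<^sup>T = QK" unfolding QK' by (rule Diag_transpose)
    have AQT: "(AK * QK)\<^sup>T = QK * AK\<^sup>T" using transpose_mult[OF AKc QKc] QT by simp
    have M: "AJ * pinv AJ * AK * QK - AK * QK \<in> carrier_mat m (card K)"
      by (rule minus_carrier_mat[OF CQ])
    have "(AJ * pinv AJ * AK * QK - AK * QK)\<^sup>T = (AJ * pinv AJ * (AK * QK))\<^sup>T - (AK * QK)\<^sup>T"
      unfolding assoc[OF fr, symmetric] using Pc CQ by (intro transpose_minus) auto
    also have "(AJ * pinv AJ * (AK * QK))\<^sup>T = (QK * AK\<^sup>T) * (AJ * pinv AJ)"
      using transpose_mult[OF Pc CQ] P(3) AQT by simp
    also have "\<dots> = QK * AK\<^sup>T * AJ * pinv AJ"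
      using QKc AKc AJc P(1)
      by (subst assoc_mult_mat[of "QK * AK\<^sup>T" "card K" m AJ "card J" "pinv AJ" m]) auto
    finally have "(AJ * pinv AJ * AK * QK - AK * QK)\<^sup>T = QK * AK\<^sup>T * AJ * pinv AJ - QK * AK\<^sup>T"
      unfolding AQT .
    then show ?thesis using gordan_mat[OF M] by simp
  qed
  then show ?thesis using i_ii i_iii by blast
qed

end
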